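(* Suppose the problem $\min_{x\in V}\{f(x):\mathcal{A}(x)=b,\ x\in\mathcal{K}\}$ is $(\mu,r,\ell)$-sharp around $x^\natural$, and let $F_{r,\ell}(x)=f(x)+r\|\mathcal{A}(x)-b\|+\ell\operatorname{dist}(x,\mathcal{K})$. Let $\delta\in W$ and set $\tilde b=b+\delta$. (1) If $\tilde x$ minimizes $$\tilde F_{r,\ell}(x):=f(x)+r\|\mathcal{A}(x)-\tilde b\|+\ell\operatorname{dist}(x,\mathcal{K}),$$ then $\|\tilde x-x^\natural\|\le\frac{2r}{\mu}\|\delta\|$. (2) If $\tilde x$ minimizes $$\tilde F^{\mathrm{thresh}}_{r,\ell}(x):=\max\left(\tilde F_{r,\ell}(x),\ F_{r,\ell}(x^\natural)+3r\|\delta\|\right),$$ then $\|\tilde x-x^\natural\|\le\frac{4r}{\mu}\|\delta\|$. Furthermore, $\tilde F^{\mathrm{thresh}}_{r,\ell}$ is $\frac{\mu}{2}$-sharp around its set of optimizers.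
   Context: $V$ and $W$ are Euclidean spaces each equipped with a norm (not necessarily the Euclidean one); $\|\cdot\|$ denotes the norm of the space its argument lies in. $\mathcal{A}:V\to W$ is linear, $x^\natural\in V$, $b=\mathcal{A}(x^\natural)\in W$, $f:V\to\mathbb{R}$ is convex, $\mathcal{K}\subseteq V$ is a closed convex cone (possibly all of $V$). For a closed nonempty set $\mathcal{X}\subseteq V$, $\operatorname{dist}(x,\mathcal{X})=\min_{y\in\mathcal{X}}\|x-y\|$ in the norm of $V$. A convex $F:V\to\mathbb{R}$ is $\mu$-sharp ($\mu>0$) around a nonempty convex set $\mathcal{X}$ if $\mathcal{X}=\arg\min F$ and $F(\bar x)-\min F\ge\mu\operatorname{dist}(\bar x,\mathcal{X})$ for all $\bar x\in V$. For $\mu>0$ and $r,\ell\ge0$, the problem $\min_{x\in V}\{f(x):\mathcal{A}(x)=b,\ x\in\mathcal{K}\}$ is $(\mu,r,\ell)$-sharp around $x^\natural$ if $x^\natural$ is feasible and $F_{r,\ell}$ is $\mu$-sharp around $\{x^\natural\}$. *)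

theory Defs
  imports "HOL-Analysis.Analysis"
begin

definition finite_dim :: "'a::real_vector set \<Rightarrow> bool" where
  "finite_dim S \<longleftrightarrow> (\<exists>B. finite B \<and> span B = S)"

definition minimizes :: "('a \<Rightarrow> real) \<Rightarrow> 'a \<Rightarrow> bool" where
  "minimizes F x \<longleftrightarrow> is_arg_min F (\<lambda>_. True) x"

definition argmin_set :: "('a \<Rightarrow> real) \<Rightarrow> 'a set" where
  "argmin_set F = {x. minimizes F x}"

(* The infimum of F is its minimum here: X is nonempty and consists of minimizers. Likewise,
   infdist is an attained distance whenever X is closed and the space is finite-dimensional. *)
definition sharp :: "real \<Rightarrow> ('a::real_normed_vector \<Rightarrow> real) \<Rightarrow> 'a set \<Rightarrow> bool" where
  "sharp \<mu> F X \<longleftrightarrow> \<mu> > 0 \<and> convex_on UNIV F \<and> X \<noteq> {} \<and> convex X \<and> X = argmin_set F \<and>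
     (\<forall>x. F x - (INF y. F y) \<ge> \<mu> * infdist x X)"

definition penalized ::
  "('v::real_normed_vector \<Rightarrow> real) \<Rightarrow> ('v \<Rightarrow> 'w::real_normed_vector) \<Rightarrow> 'w \<Rightarrow> 'v set \<Rightarrow>
   real \<Rightarrow> real \<Rightarrow> 'v \<Rightarrow> real" where
  "penalized f A b K r l x = f x + r * norm (A x - b) + l * infdist x K"

definition penalized_thresh ::
  "('v::real_normed_vector \<Rightarrow> real) \<Rightarrow> ('v \<Rightarrow> 'w::real_normed_vector) \<Rightarrow> 'w \<Rightarrow> 'w \<Rightarrow> 'v set \<Rightarrow>
   real \<Rightarrow> real \<Rightarrow> 'v \<Rightarrow> 'v \<Rightarrow> real" where
  "penalized_thresh f A b \<delta> K r l x0 x =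
     max (penalized f A (b + \<delta>) K r l x) (penalized f A b K r l x0 + 3 * r * norm \<delta>)"

definition problem_sharp ::
  "('v::real_normed_vector \<Rightarrow> real) \<Rightarrow> ('v \<Rightarrow> 'w::real_normed_vector) \<Rightarrow> 'w \<Rightarrow> 'v set \<Rightarrow>
   real \<Rightarrow> real \<Rightarrow> real \<Rightarrow> 'v \<Rightarrow> bool" where
  "problem_sharp f A b K \<mu> r l x0 \<longleftrightarrow> \<mu> > 0 \<and> r \<ge> 0 \<and> l \<ge> 0 \<and> A x0 = b \<and> x0 \<in> K \<and>
     sharp \<mu> (penalized f A b K r l) {x0}"

end

theory Submission
  imports Defs
begin

text \<open>
  Write F for the penalized objective with data b, G for the one with data b + \<delta>, and
  e = r * norm \<delta>. By the triangle inequality F and G differ by at most e everywhere, and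
  sharpness says that F grows at rate \<mu> away from x0.

  A point whose F-value exceeds the minimum by at most \<eta> therefore lies within \<eta> / \<mu> of x0
  (\<open>near_minimizer_norm_le\<close>). A minimizer of G has an F-value at most 2e above F x0, which
  gives the first bound. The threshold c = F x0 + 3e is at least G x0 + 2e, so the minimizers of
  max G c are exactly the points with G \<le> c; their F-values are at most 4e above F x0,
  which gives the second bound.

  For the sharpness of max G c, the gap between G x0 and c is what matters. Close to x0 the error e
  destroys the growth of G, but at a point x with G x > c two lower bounds hold for
  G x - G x0: the growth \<mu> * norm (x - x0) - 2e inherited from F, and the gap 2e.
  Their sum is \<mu> * norm (x - x0), so G x - G x0 is at least half of that. On the
  segment from x0 to x convexity of G turns this average slope into a slope of at least
  \<mu> / 2 on the part beyond the level set of c (\<open>sharp_max_sublevel\<close>).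
\<close>

lemma minimizes_iff: "minimizes F x \<longleftrightarrow> (\<forall>y. F x \<le> F y)"
  by (simp add: minimizes_def is_arg_min_linorder)

lemma INF_eq_of_minimizes:
  assumes "minimizes F x"
  shows "(INF y. F y) = F x"
  using assms by (intro cInf_eq_minimum) (auto simp: minimizes_iff)

lemma sharp_singleton_growth:
  assumes "sharp \<mu> F {a}"
  shows "F a + \<mu> * norm (x - a) \<le> F x"
proof -
  have "a \<in> argmin_set F"
    using assms unfolding sharp_def by blast
  then have "(INF y. F y) = F a"
    by (simp add: INF_eq_of_minimizes argmin_set_def)
  then show ?thesis
    using assms by (simp add: sharp_def dist_norm algebra_simps)
qed

lemma near_minimizer_norm_le:
  assumes "sharp \<mu> F {a}" and "F x \<le> F a + \<eta>"
  shows "norm (x - a) \<le> \<eta> / \<mu>"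
proof -
  have "\<mu> > 0" using assms by (simp add: sharp_def)
  moreover have "\<mu> * norm (x - a) \<le> \<eta>"
    using sharp_singleton_growth[OF assms(1), of x] assms(2) by simp
  ultimately show ?thesis by (simp add: field_simps)
qed

text \<open>
  A convex combination of points of C that nearly realize the two distances is again in C. The
  distance need not be attained, whence the slack.
\<close>
lemma convex_on_infdist:
  fixes C :: "'a::real_normed_vector set"
  assumes "convex C" and "C \<noteq> {}"
  shows "convex_on UNIV (\<lambda>x. infdist x C)"
proof (rule convex_onI)
  fix t :: real and x y :: 'a
  assume t: "t > 0" "t < 1"
  have near: "\<exists>p\<in>C. dist z p < infdist z C + \<epsilon>" if "\<epsilon> > 0" for z :: 'a and \<epsilon> :: real
    using that assms(2) cInf_lessD[of "dist z ` C" "infdist z C + \<epsilon>"]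
    by (auto simp: infdist_notempty)
  show "infdist ((1 - t) *\<^sub>R x + t *\<^sub>R y) C \<le> (1 - t) * infdist x C + t * infdist y C"
  proof (rule field_le_epsilon)
    fix \<epsilon> :: real
    assume "\<epsilon> > 0"
    then obtain p q where p: "p \<in> C" "dist x p < infdist x C + \<epsilon>"
      and q: "q \<in> C" "dist y q < infdist y C + \<epsilon>"
      using near by meson
    have "(1 - t) *\<^sub>R p + t *\<^sub>R q \<in> C"
      using assms(1) p(1) q(1) t by (simp add: convex_alt)
    then have "infdist ((1 - t) *\<^sub>R x + t *\<^sub>R y) C
        \<le> dist ((1 - t) *\<^sub>R x + t *\<^sub>R y) ((1 - t) *\<^sub>R p + t *\<^sub>R q)"
      by (rule infdist_le)
    also have "\<dots> = norm ((1 - t) *\<^sub>R (x - p) + t *\<^sub>R (y - q))"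
      by (simp add: dist_norm algebra_simps)
    also have "\<dots> \<le> (1 - t) * dist x p + t * dist y q"
      using t norm_triangle_ineq[of "(1 - t) *\<^sub>R (x - p)" "t *\<^sub>R (y - q)"]
      by (simp add: dist_norm)
    also have "\<dots> \<le> (1 - t) * (infdist x C + \<epsilon>) + t * (infdist y C + \<epsilon>)"
      using t p(2) q(2) by (intro add_mono mult_left_mono) auto
    also have "\<dots> = (1 - t) * infdist x C + t * infdist y C + \<epsilon>"
      by (simp add: algebra_simps)
    finally show "infdist ((1 - t) *\<^sub>R x + t *\<^sub>R y) C
        \<le> (1 - t) * infdist x C + t * infdist y C + \<epsilon>" .
  qed
qed simp

lemma convex_on_norm_affine:
  assumes "linear A"
  shows "convex_on UNIV (\<lambda>x. norm (A x - b))"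
proof (rule convex_onI)
  fix t :: real and x y
  assume t: "t > 0" "t < 1"
  have "A ((1 - t) *\<^sub>R x + t *\<^sub>R y) - b = (1 - t) *\<^sub>R (A x - b) + t *\<^sub>R (A y - b)"
    by (simp add: linear_add[OF assms] linear_scale[OF assms] scaleR_diff_right)
       (simp add: algebra_simps)
  then show "norm (A ((1 - t) *\<^sub>R x + t *\<^sub>R y) - b) \<le> (1 - t) * norm (A x - b) + t * norm (A y - b)"
    using t norm_triangle_ineq[of "(1 - t) *\<^sub>R (A x - b)" "t *\<^sub>R (A y - b)"] by simp
qed simp

lemma convex_on_max:
  fixes f g :: "'a::real_vector \<Rightarrow> real"
  assumes "convex_on S f" and "convex_on S g"
  shows "convex_on S (\<lambda>x. max (f x) (g x))"
proof (rule convex_onI)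
  fix t :: real and x y
  assume t: "t > 0" "t < 1" and xy: "x \<in> S" "y \<in> S"
  let ?m = "(1 - t) * max (f x) (g x) + t * max (f y) (g y)"
  have "(1 - t) * f x + t * f y \<le> ?m" and "(1 - t) * g x + t * g y \<le> ?m"
    using t by (auto intro!: add_mono mult_left_mono)
  then show "max (f ((1 - t) *\<^sub>R x + t *\<^sub>R y)) (g ((1 - t) *\<^sub>R x + t *\<^sub>R y)) \<le> ?m"
    using convex_onD[OF assms(1), of t x y] convex_onD[OF assms(2), of t x y] t xy by simp
qed (rule convex_on_imp_convex[OF assms(1)])

lemma convex_on_penalized:
  assumes "convex_on UNIV f" and "linear A" and "convex K" and "K \<noteq> {}" and "r \<ge> 0" and "l \<ge> 0"
  shows "convex_on UNIV (penalized f A b K r l)"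
proof -
  have "convex_on UNIV (\<lambda>x. f x + r * norm (A x - b) + l * infdist x K)"
    using assms by (intro convex_on_add convex_on_cmul convex_on_norm_affine convex_on_infdist)
  then show ?thesis
    by (simp add: penalized_def[abs_def])
qed

lemma penalized_perturbation:
  assumes "r \<ge> 0"
  shows "\<bar>penalized f A (b + \<delta>) K r l x - penalized f A b K r l x\<bar> \<le> r * norm \<delta>"
proof -
  have "\<bar>norm (A x - (b + \<delta>)) - norm (A x - b)\<bar> \<le> norm \<delta>"
    using norm_triangle_ineq3[of "A x - (b + \<delta>)" "A x - b"] by simp
  then have "r * \<bar>norm (A x - (b + \<delta>)) - norm (A x - b)\<bar> \<le> r * norm \<delta>"
    using assms by (rule mult_left_mono)
  then show ?thesis
    using assms by (simp add: penalized_def abs_mult flip: right_diff_distrib)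
qed

lemma argmin_set_max_const:
  assumes "G a \<le> c"
  shows "argmin_set (\<lambda>x. max (G x) c) = {x. G x \<le> c}"
proof -
  have "minimizes (\<lambda>x. max (G x) c) x \<longleftrightarrow> G x \<le> c" for x
    using assms by (force simp: minimizes_iff max_def)
  then show ?thesis
    by (simp add: argmin_set_def)
qed

text \<open>
  Growth of a convex function relative to a single point a of a sublevel set gives growth relative
  to the whole sublevel set: going from a point x outside towards a, the value c is reached
  after the fraction (G x - c) / (G x - G a) of the way at the latest, so the distance to the
  sublevel set is at most that fraction of the distance to a.
\<close>
lemma sharp_max_sublevel:
  fixes G :: "'a::real_normed_vector \<Rightarrow> real"
  assumes "convex_on UNIV G" and "\<nu> > 0" and "G a \<le> c"
    and growth: "\<And>x. G x > c \<Longrightarrow> \<nu> * norm (x - a) \<le> G x - G a"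
  shows "sharp \<nu> (\<lambda>x. max (G x) c) (argmin_set (\<lambda>x. max (G x) c))"
proof -
  define X where "X = {x. G x \<le> c}"
  have X: "argmin_set (\<lambda>x. max (G x) c) = X"
    using assms(3) by (simp add: argmin_set_max_const X_def)
  have "a \<in> X" using assms(3) by (simp add: X_def)
  then have "minimizes (\<lambda>x. max (G x) c) a"
    using X by (auto simp: argmin_set_def)
  then have min: "(INF y. max (G y) c) = c"
    using assms(3) by (simp add: INF_eq_of_minimizes)
  have "convex X"
    unfolding X_def
  proof (rule convexI)
    fix x y and u v :: real
    assume "x \<in> {x. G x \<le> c}" "y \<in> {x. G x \<le> c}" and uv: "0 \<le> u" "0 \<le> v" "u + v = 1"
    then have "u * G x + v * G y \<le> c"
      by (intro convex_bound_le) auto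
    moreover have "u = 1 - v" using uv by simp
    ultimately show "u *\<^sub>R x + v *\<^sub>R y \<in> {x. G x \<le> c}"
      using convex_onD[OF assms(1), of v x y] uv(1,2) by simp
  qed
  have "\<nu> * infdist x X \<le> max (G x) c - c" for x
  proof (cases "G x \<le> c")
    case True
    then show ?thesis by (simp add: X_def)
  next
    case False
    define s where "s = (G x - c) / (G x - G a)"
    have pos: "G x - G a > 0" using False assms(3) by simp
    then have s: "0 \<le> s" "s \<le> 1" and s_mult: "s * (G x - G a) = G x - c"
      using False assms(3) by (simp_all add: s_def field_simps)
    define y where "y = (1 - s) *\<^sub>R x + s *\<^sub>R a"
    have "G y \<le> (1 - s) * G x + s * G a"
      using convex_onD[OF assms(1), of s x a] s by (simp add: y_def)
    also have "\<dots> = c" using s_mult by (simp add: algebra_simps)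
    finally have "y \<in> X" by (simp add: X_def)
    then have "infdist x X \<le> dist x y" by (rule infdist_le)
    also have "x - y = s *\<^sub>R (x - a)" by (simp add: y_def algebra_simps)
    then have "dist x y = s * norm (x - a)" using s by (simp add: dist_norm)
    finally have "\<nu> * infdist x X \<le> s * (\<nu> * norm (x - a))"
      using assms(2) by (simp add: mult.left_commute)
    also have "\<dots> \<le> s * (G x - G a)"
      using growth[of x] False s by (intro mult_left_mono) auto
    finally show ?thesis using s_mult False by simp
  qed
  moreover have "convex_on UNIV (\<lambda>x. max (G x) c)"
    using assms(1) by (intro convex_on_max) (simp_all add: convex_on_const)
  ultimately show ?thesis
    using assms(2) \<open>a \<in> X\<close> \<open>convex X\<close> X min by (auto simp: sharp_def)
qed

theorem proposition2:
  fixes f :: "'v::real_normed_vector \<Rightarrow> real"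
    and A :: "'v \<Rightarrow> 'w::real_normed_vector"
    and K :: "'v set" and x0 :: 'v and b \<delta> :: 'w and \<mu> r l :: real
  assumes "finite_dim (UNIV :: 'v set)" and "finite_dim (UNIV :: 'w set)"
    and "linear A" and "b = A x0"
    and "convex_on UNIV f"
    and "closed K" and "convex K" and "cone K"
    and "problem_sharp f A b K \<mu> r l x0"
  shows "(\<forall>x. minimizes (penalized f A (b + \<delta>) K r l) x \<longrightarrow>
            norm (x - x0) \<le> 2 * r / \<mu> * norm \<delta>) \<and>
         (\<forall>x. minimizes (penalized_thresh f A b \<delta> K r l x0) x \<longrightarrow>
            norm (x - x0) \<le> 4 * r / \<mu> * norm \<delta>) \<and>
         sharp (\<mu> / 2) (penalized_thresh f A b \<delta> K r l x0)
           (argmin_set (penalized_thresh f A b \<delta> K r l x0))"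
proof -
  define F where "F = penalized f A b K r l"
  define G where "G = penalized f A (b + \<delta>) K r l"
  define e where "e = r * norm \<delta>"
  define c where "c = F x0 + 3 * e"
  have \<mu>: "\<mu> > 0" and r: "r \<ge> 0" and l: "l \<ge> 0" and "x0 \<in> K" and sharp: "sharp \<mu> F {x0}"
    using assms(9) by (auto simp: problem_sharp_def F_def)
  have thresh: "penalized_thresh f A b \<delta> K r l x0 = (\<lambda>x. max (G x) c)"
    by (simp add: fun_eq_iff penalized_thresh_def F_def G_def c_def e_def mult.assoc)
  have "e \<ge> 0" using r by (simp add: e_def)
  have diff: "\<bar>G x - F x\<bar> \<le> e" for x
    using penalized_perturbation[OF r] by (simp add: F_def G_def e_def)
  have gap: "G x0 + 2 * e \<le> c"
    using diff[of x0] by (simp add: c_def)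

  have "norm (x - x0) \<le> 2 * r / \<mu> * norm \<delta>" if "minimizes G x" for x
  proof -
    have "G x \<le> G x0" using that by (simp add: minimizes_iff)
    then have "F x \<le> F x0 + 2 * e"
      using diff[of x] diff[of x0] by simp
    then show ?thesis
      using near_minimizer_norm_le[OF sharp] by (force simp: e_def)
  qed
  moreover have "norm (x - x0) \<le> 4 * r / \<mu> * norm \<delta>" if "minimizes (\<lambda>x. max (G x) c) x" for x
  proof -
    have "G x \<le> c"
      using that argmin_set_max_const[of G x0 c] gap \<open>e \<ge> 0\<close> by (auto simp: argmin_set_def)
    then have "F x \<le> F x0 + 4 * e"
      using diff[of x] by (simp add: c_def)
    then show ?thesis
      using near_minimizer_norm_le[OF sharp] by (force simp: e_def)
  qed
  moreover have "sharp (\<mu> / 2) (\<lambda>x. max (G x) c) (argmin_set (\<lambda>x. max (G x) c))"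
  proof (rule sharp_max_sublevel)
    show "convex_on UNIV G"
      unfolding G_def using assms(3,5,7) r l \<open>x0 \<in> K\<close> by (intro convex_on_penalized) auto
    show "\<mu> / 2 > 0" using \<mu> by simp
    show "G x0 \<le> c" using gap \<open>e \<ge> 0\<close> by simp
    fix x
    assume "G x > c"
    then have "G x - G x0 \<ge> 2 * e" using gap by simp
    moreover have "G x - G x0 \<ge> \<mu> * norm (x - x0) - 2 * e"
      using sharp_singleton_growth[OF sharp, of x] diff[of x] diff[of x0] by simp
    ultimately show "\<mu> / 2 * norm (x - x0) \<le> G x - G x0" by simp
  qed
  ultimately show ?thesis
    unfolding thresh by (simp add: G_def)
qed

end
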